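(* Let $p=(2143,R)$ with $R=([3]\times\{0\})\cup([4]\times\{4\})$ (the whole top row of boxes shaded, and the bottom row shaded except for its rightmost box $(4,0)$). Then for every $n\ge4$, \[ s_n^+(p)=\sum_{q=1}^{n-3}\sum_{k=1}^{n-q-2}\sum_{\ell=1}^{n-q-1-k}\frac{(n-2)!}{\binom{n-2}{q-1}}\binom{n-k-\ell-2}{q-1}\left(1-\binom{k+\ell}{k}^{-1}\right), \] and \[ \lim_{n\to\infty}\frac{s_n^+(p)}{n!}=1. \]
   Context: For $n\ge1$, $S_n$ is the set of permutations of $\{1,\dots,n\}$ in one-line notation $\tau=\tau_1\cdots\tau_n$. For an integer $k\ge0$ write $[k]=\{0,1,\dots,k\}$. A mesh pattern of length $k$ is a pair $(\pi,R)$ with $\pi\in S_k$ and $R\subseteq[k]\times[k]$; the elements $(x,y)\in R$ are the shaded boxes (box $(x,y)$ is the unit square with south-west corner $(x,y)$ in the plot of the points $(i,\pi_i)$). An occurrence of $(\pi,R)$ in $\tau\in S_n$ is a choice of positions $i_1<\dots<i_k$ such that $\tau_{i_a}<\tau_{i_b}$ iff $\pi_a<\pi_b$ for all $a,b$, and such that for every $(x,y)\in R$ there is no index $m$ with $i_x<m<i_{x+1}$ and $v_y<\tau_m<v_{y+1}$, where $i_0=0$, $i_{k+1}=n+1$, $v_0=0$, $v_{k+1}=n+1$, and for $1\le y\le k$, $v_y$ is the $y$-th smallest of the values $\tau_{i_1},\dots,\tau_{i_k}$. A permutation contains a mesh pattern if it has at least one occurrence of it, and $s_n^+(p)$ denotes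 the number of permutations in $S_n$ containing $p$. *)

theory Defs
  imports Complex_Main "HOL-Combinatorics.Multiset_Permutations"
begin

text \<open>
  A permutation in one-line notation is a list; \<open>S_n\<close> is the library set
  \<open>permutations_of_set {1..n}\<close>. Positions in permutations are numbered from 1.
\<close>

definition entry :: "nat list \<Rightarrow> nat \<Rightarrow> nat" where
  "entry \<tau> i = \<tau> ! (i - 1)"

type_synonym mesh_pattern = "nat list \<times> (nat \<times> nat) set"

definition is_mesh_pattern :: "nat \<Rightarrow> mesh_pattern \<Rightarrow> bool" where
  "is_mesh_pattern k p \<longleftrightarrow>
     fst p \<in> permutations_of_set {1..k} \<and> snd p \<subseteq> {0..k} \<times> {0..k}"

text \<open>
  The list \<open>js = [i\<^sub>1, ..., i\<^sub>k]\<close> holds the chosen positions. The bordered lists \<open>P\<close> and \<open>V\<close>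
  are indexed from 0, so that \<open>P ! x\<close> is \<open>i\<^sub>x\<close> and \<open>V ! y\<close> is \<open>v\<^sub>y\<close> for indices \<open>0, ..., k + 1\<close>.
\<close>

definition mesh_occurrence :: "mesh_pattern \<Rightarrow> nat list \<Rightarrow> nat list \<Rightarrow> bool" where
  "mesh_occurrence p \<tau> js \<longleftrightarrow>
     (let \<pi> = fst p; R = snd p; k = length \<pi>; n = length \<tau>;
          P = 0 # js @ [n + 1];
          V = 0 # sort (map (entry \<tau>) js) @ [n + 1]
      in length js = k \<and> sorted_wrt (<) js \<and> set js \<subseteq> {1..n} \<and>
         (\<forall>a\<in>{1..k}. \<forall>b\<in>{1..k}.
            entry \<tau> (P ! a) < entry \<tau> (P ! b) \<longleftrightarrow> entry \<pi> a < entry \<pi> b) \<and>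
         (\<forall>(x, y)\<in>R. \<not> (\<exists>m\<in>{1..n}. P ! x < m \<and> m < P ! (x + 1) \<and>
            V ! y < entry \<tau> m \<and> entry \<tau> m < V ! (y + 1))))"

definition mesh_contains :: "nat list \<Rightarrow> mesh_pattern \<Rightarrow> bool" where
  "mesh_contains \<tau> p \<longleftrightarrow> (\<exists>js. mesh_occurrence p \<tau> js)"

definition s_plus :: "nat \<Rightarrow> mesh_pattern \<Rightarrow> nat" where
  "s_plus n p = card {\<tau> \<in> permutations_of_set {1..n}. mesh_contains \<tau> p}"

definition pattern_2143 :: mesh_pattern where
  "pattern_2143 = ([2, 1, 4, 3], ({0..3} \<times> {0}) \<union> ({0..4} \<times> {4}))"

lemma is_mesh_pattern_2143: "is_mesh_pattern 4 pattern_2143"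
  unfolding is_mesh_pattern_def pattern_2143_def permutations_of_set_def by auto

end

theory Submission
  imports Defs
begin

text \<open>
  The shaded top row forces the letter \<open>4\<close> of the pattern to be the entry \<open>n\<close>, and the shaded
  boxes of the bottom row force the letter \<open>1\<close> to be a minimum \<open>q\<close> of all entries up to the
  letter \<open>3\<close>. So a permutation containing the pattern is uniquely of the form \<open>A q B n C D\<close>, where
  the entries of \<open>A\<close>, \<open>B\<close>, \<open>C\<close> exceed \<open>q\<close>, the word \<open>D\<close> is empty or starts below \<open>q\<close>, and some
  entry of \<open>A\<close> lies below some entry of \<open>C\<close>. As \<open>B\<close> and \<open>D\<close> can be recovered from \<open>W = B D\<close>, one
  may count the triples \<open>(A, C, W)\<close> instead: \<open>A C W\<close> is an arrangement of \<open>{1..n} - {q, n}\<close> whose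
  first \<open>k + l = |A| + |C|\<close> entries exceed \<open>q\<close>, and one excludes the arrangements in which \<open>A\<close>
  consists of the \<open>k\<close> largest of these.

  For the limit, summing over \<open>q\<close> first (hockey stick) turns the formula into
  \<open>\<Sum>s. \<Sum>k. (n - 1)! / (s + 1) * (1 - 1 / (s choose k))\<close> with \<open>s = k + l\<close>. From \<open>s \<le> s choose k\<close> the
  inner sum divided by \<open>(n - 1)!\<close> is at least \<open>1 - 3 / (s + 1)\<close>, so the proportion is at least
  \<open>1 - 3 / n - 3 ln n / n\<close>.
\<close>

subsection \<open>Decomposition of the permutations containing the pattern\<close>

text \<open>Positions in an occurrence count from 1, the indices on the right from 0. An entry above
  the letter \<open>4\<close> would lie in a box of the top row, and an entry below the letter
  \<open>1\<close> and left of the letter \<open>3\<close> in one of the boxes \<open>(0,0)\<close>,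
  ..., \<open>(3,0)\<close>. That the letter \<open>3\<close> lies below the letter \<open>4\<close>
  need not be listed, since \<open>n\<close> is the maximum and occurs only once.\<close>

lemma mesh_contains_2143_iff:
  assumes "\<tau> \<in> permutations_of_set {1..n}"
  shows "mesh_contains \<tau> pattern_2143 \<longleftrightarrow>
    (\<exists>i j k l. i < j \<and> j < k \<and> k < l \<and> l < n \<and> \<tau> ! j < \<tau> ! i \<and> \<tau> ! i < \<tau> ! l \<and>
       \<tau> ! k = n \<and> (\<forall>m<l. \<tau> ! j \<le> \<tau> ! m))"
    (is "_ \<longleftrightarrow> ?R")
proof -
  have len: "length \<tau> = n" and dist: "distinct \<tau>" and setT: "set \<tau> = {1..n}"
    using assms by (auto simp: permutations_of_set_def length_finite_permutations_of_set[OF assms])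
  have bnd: "1 \<le> \<tau> ! m \<and> \<tau> ! m \<le> n" if "m < n" for m
    using nth_mem[of m \<tau>] that len setT by auto
  have vals: "{1..4} = {1, 2, 3, 4::nat}" by auto
  show ?thesis
  proof
    assume "mesh_contains \<tau> pattern_2143"
    then obtain js where occ: "mesh_occurrence pattern_2143 \<tau> js"
      by (auto simp: mesh_contains_def)
    then have "length js = 4"
      by (simp add: mesh_occurrence_def pattern_2143_def Let_def)
    then obtain a b c d where js: "js = [a, b, c, d]"
      by (auto simp: length_Suc_conv eval_nat_numeral)
    have ord: "a < b" "b < c" "c < d" "1 \<le> a" "d \<le> n"
      using occ by (auto simp: mesh_occurrence_def pattern_2143_def Let_def js len)
    have iso: "\<forall>x\<in>{1..4}. \<forall>y\<in>{1..4}.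
        entry \<tau> ((0 # js @ [n + 1]) ! x) < entry \<tau> ((0 # js @ [n + 1]) ! y)
          \<longleftrightarrow> entry [2, 1, 4, 3] x < entry [2, 1, 4, 3] y"
      using occ by (simp add: mesh_occurrence_def pattern_2143_def Let_def len)
    have val: "entry \<tau> b < entry \<tau> a" "entry \<tau> a < entry \<tau> d" "entry \<tau> d < entry \<tau> c"
      using iso[rule_format, of 2 1] iso[rule_format, of 1 4] iso[rule_format, of 4 3]
      by (simp_all add: js entry_def numeral_eq_Suc)
    \<comment> \<open>With the values sorted explicitly, the horizontal borders of all boxes become
      concrete entries.\<close>
    have srt: "sort (map (entry \<tau>) js) = [entry \<tau> b, entry \<tau> a, entry \<tau> d, entry \<tau> c]"
      using val by (simp add: js)
    have shade: "\<not> ((0 # [entry \<tau> b, entry \<tau> a, entry \<tau> d, entry \<tau> c] @ [n + 1]) ! y < entry \<tau> m \<and>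
           entry \<tau> m < (0 # [entry \<tau> b, entry \<tau> a, entry \<tau> d, entry \<tau> c] @ [n + 1]) ! (y + 1))"
      if "(x, y) \<in> {0..3} \<times> {0} \<union> {0..4} \<times> {4}" "m \<in> {1..n}"
        "(0 # js @ [n + 1]) ! x < m" "m < (0 # js @ [n + 1]) ! (x + 1)" for x y m
      using occ that unfolding mesh_occurrence_def pattern_2143_def Let_def fst_conv snd_conv srt len by blast
    have top: "entry \<tau> m \<le> entry \<tau> c" if m: "m \<in> {1..n}" for m
    proof (rule ccontr)
      assume gt: "\<not> ?thesis"
      have "entry \<tau> m \<le> n" using bnd[of "m - 1"] m by (auto simp: entry_def)
      moreover have "m \<noteq> a" "m \<noteq> b" "m \<noteq> c" "m \<noteq> d" using gt val by auto
      \<comment> \<open>One case per column of the grid; each meets the top row in a shaded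
        box.\<close>
      then consider "m < a" | "a < m \<and> m < b" | "b < m \<and> m < c" | "c < m \<and> m < d" | "d < m"
        by linarith
      ultimately show False
        using gt m shade[of 0 4 m] shade[of 1 4 m]
          shade[of 2 4 m] shade[of 3 4 m]
          shade[of 4 4 m]
        by cases (auto simp: js numeral_eq_Suc)
    qed
    \<comment> \<open>Box \<open>(4,0)\<close> is not shaded, so nothing is known to the right of
      \<open>d\<close>.\<close>
    have bot: "entry \<tau> b \<le> entry \<tau> m" if m: "m \<in> {1..n}" "m < d" for m
    proof (rule ccontr)
      assume gt: "\<not> ?thesis"
      have "1 \<le> entry \<tau> m" using bnd[of "m - 1"] m by (auto simp: entry_def)
      moreover have "m \<noteq> a" "m \<noteq> b" "m \<noteq> c" using gt val by auto
      then consider "m < a" | "a < m \<and> m < b" | "b < m \<and> m < c" | "c < m \<and> m < d"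
        using m by linarith
      ultimately show False
        using gt m shade[of 0 0 m] shade[of 1 0 m]
          shade[of 2 0 m] shade[of 3 0 m]
        by cases (auto simp: js numeral_eq_Suc)
    qed
    have "n \<in> set \<tau>" using setT ord by auto
    then obtain m where "m < n" "\<tau> ! m = n" using len by (auto simp: in_set_conv_nth)
    then have "entry \<tau> c = n"
      using top[of "Suc m"] bnd[of "c - 1"] ord by (auto simp: entry_def)
    moreover have "\<forall>m<d - 1. \<tau> ! (b - 1) \<le> \<tau> ! m"
    proof (intro allI impI)
      fix m assume "m < d - 1"
      then show "\<tau> ! (b - 1) \<le> \<tau> ! m"
        using bot[of "Suc m"] ord by (simp add: entry_def)
    qed
    moreover have "a - 1 < b - 1" "b - 1 < c - 1" "c - 1 < d - 1" "d - 1 < n" using ord by auto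
    ultimately show ?R using val unfolding entry_def by blast
  next
    assume ?R
    then obtain i j k l where ord: "i < j" "j < k" "k < l" "l < n"
      and val: "\<tau> ! j < \<tau> ! i" "\<tau> ! i < \<tau> ! l" and top: "\<tau> ! k = n"
      and bot: "\<And>m. m < l \<Longrightarrow> \<tau> ! j \<le> \<tau> ! m"
      by blast
    \<comment> \<open>This recovers the comparison between the letters \<open>3\<close> and
      \<open>4\<close>.\<close>
    have "\<tau> ! l \<noteq> n" using ord top dist len by (metis nth_eq_iff_index_eq less_trans nat_neq_iff)
    then have val': "\<tau> ! l < n" using bnd[of l] ord by auto
    let ?js = "[Suc i, Suc j, Suc k, Suc l]"
    have srt: "sort (map (entry \<tau>) ?js) = [\<tau> ! j, \<tau> ! i, \<tau> ! l, \<tau> ! k]"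
      using val val' top by (simp add: entry_def)
    have noTop: "\<not> n < entry \<tau> m" if "m \<in> {1..n}" for m
    proof -
      have "m - 1 < n" using that by auto
      then show ?thesis using bnd[of "m - 1"] by (simp add: entry_def)
    qed
    have noBot: "\<not> entry \<tau> m < \<tau> ! j" if "m < Suc l" "m \<in> {1..n}" for m
    proof -
      have "m - 1 < l" using that by auto
      then show ?thesis using bot[of "m - 1"] by (simp add: entry_def not_less)
    qed
    have shade: "\<not> ((0 # [\<tau> ! j, \<tau> ! i, \<tau> ! l, \<tau> ! k] @ [n + 1]) ! y < entry \<tau> m \<and>
           entry \<tau> m < (0 # [\<tau> ! j, \<tau> ! i, \<tau> ! l, \<tau> ! k] @ [n + 1]) ! (y + 1))"
      if xy: "(x, y) \<in> {0..3} \<times> {0} \<union> {0..4} \<times> {4}" and m: "m \<in> {1..n}"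
        "(0 # ?js @ [n + 1]) ! x < m" "m < (0 # ?js @ [n + 1]) ! (x + 1)" for x y m
    proof (cases "y = 4")
      case True
      then show ?thesis using noTop m top by (simp add: numeral_eq_Suc)
    next
      case False
      with xy have "y = 0" "x \<in> {0, 1, 2, 3}" by auto
      then have "m < Suc l" using m ord by (auto simp: numeral_eq_Suc)
      then show ?thesis using noBot m \<open>y = 0\<close> by simp
    qed
    have iso: "\<forall>x\<in>{1..4}. \<forall>y\<in>{1..4}.
        entry \<tau> ((0 # ?js @ [n + 1]) ! x) < entry \<tau> ((0 # ?js @ [n + 1]) ! y)
          \<longleftrightarrow> entry [2, 1, 4, 3] x < entry [2, 1, 4, 3] y"
      using val val' top unfolding vals by (simp add: entry_def numeral_eq_Suc)
    have "mesh_occurrence pattern_2143 \<tau> ?js"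
      unfolding mesh_occurrence_def pattern_2143_def Let_def fst_conv snd_conv srt len
      using shade iso ord by (auto simp del: nth_Cons_numeral append.simps)
    then show "mesh_contains \<tau> pattern_2143" by (auto simp: mesh_contains_def)
  qed
qed

section \<open>The canonical form \<open>A q B n C D\<close>: existence and uniqueness\<close>

definition decomposes :: "nat \<Rightarrow> nat list \<Rightarrow> nat \<Rightarrow> nat list \<Rightarrow> nat list \<Rightarrow> nat list \<Rightarrow> nat list \<Rightarrow> bool" where
  "decomposes n \<tau> q A B C D \<longleftrightarrow> \<tau> = A @ q # B @ n # C @ D \<and> (\<forall>x\<in>set A \<union> set B \<union> set C. q < x) \<and>
     (\<exists>a\<in>set A. \<exists>c\<in>set C. a < c) \<and> (D = [] \<or> hd D < q)"

lemma nth_split_two: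
  assumes "i < j" "j < length xs"
  obtains as bs cs where "xs = as @ xs ! i # bs @ xs ! j # cs" "length as = i" "length bs = j - i - 1"
proof
  let ?as = "take i xs" and ?bs = "take (j - i - 1) (drop (Suc i) xs)"
  have "xs = ?as @ xs ! i # drop (Suc i) xs"
    using assms by (simp add: id_take_nth_drop)
  also have "drop (Suc i) xs = ?bs @ xs ! j # drop (Suc j) xs"
    using assms id_take_nth_drop[of "j - i - 1" "drop (Suc i) xs"] by (simp add: Suc_diff_Suc)
  finally show "xs = ?as @ xs ! i # ?bs @ xs ! j # drop (Suc j) xs" .
qed (use assms in auto)

lemma mesh_contains_imp_decomposes:
  assumes "\<tau> \<in> permutations_of_set {1..n}" and "mesh_contains \<tau> pattern_2143"
  shows "\<exists>q A B C D. decomposes n \<tau> q A B C D"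
proof -
  have dist: "distinct \<tau>" and len: "length \<tau> = n"
    using assms by (auto simp: permutations_of_set_def length_finite_permutations_of_set[OF assms(1)])
  from assms mesh_contains_2143_iff obtain i j k l where ord: "i < j" "j < k" "k < l" "l < n"
      and val: "\<tau> ! j < \<tau> ! i" "\<tau> ! i < \<tau> ! l" "\<tau> ! k = n" "\<And>m. m < l \<Longrightarrow> \<tau> ! j \<le> \<tau> ! m"
    by blast
  define q where "q = \<tau> ! j"
  have "k < length \<tau>" using ord len by simp
  from nth_split_two[OF ord(2) this] obtain A B R
    where 1: "\<tau> = A @ q # B @ n # R" "length A = j" "length B = k - j - 1"
    unfolding q_def val(3) by blast
  \<comment> \<open>The offset of the letter \<open>3\<close> in the word \<open>R\<close> that
    follows \<open>n\<close>.\<close>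
  define r where "r = l - k - 1"
  have r: "r < length R" "l = length A + length B + 2 + r" using 1 ord len by (auto simp: r_def)
  have nth: "\<tau> ! l = R ! r" by (simp add: 1(1) r(2) nth_append nth_Cons')
  define C1 D1 where "C1 = take (Suc r) R" and "D1 = drop (Suc r) R"
  have R: "R = C1 @ D1" by (simp add: C1_def D1_def)
  have cl: "\<tau> ! l \<in> set C1"
    using r unfolding nth C1_def by (simp add: take_Suc_conv_app_nth)
  have "take (Suc l) \<tau> = A @ q # B @ n # C1"
    using r by (simp add: 1(1) C1_def numeral_eq_Suc)
  have ge: "q \<le> x" if x: "x \<in> set (take (Suc l) \<tau>)" for x
  proof -
    obtain m where "m < Suc l" "x = \<tau> ! m"
      using x ord len by (auto simp: in_set_conv_nth)
    then show ?thesis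
      using val(4)[of m] val(1,2) unfolding q_def by (cases "m = l") auto
  qed
  have gt: "q < x" if "x \<in> set A \<union> set B \<union> set C1" for x
  proof -
    have "x \<in> set (take (Suc l) \<tau>)" unfolding \<open>take (Suc l) \<tau> = _\<close> using that by auto
    moreover have "x \<noteq> q" using that dist unfolding 1(1) R by auto
    ultimately show ?thesis using ge[of x] by simp
  qed
  have ai: "\<tau> ! i \<in> set A" using 1 ord by (simp add: nth_append)
  \<comment> \<open>\<open>C1\<close> stops at the letter \<open>3\<close>, which depends on the
    chosen occurrence. Extending it as long as the entries exceed \<open>q\<close> makes
    \<open>C\<close> a maximal run and so canonical.\<close>
  define C D where "C = C1 @ takeWhile ((<) q) D1" and "D = dropWhile ((<) q) D1"
  have "decomposes n \<tau> q A B C D"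
    unfolding decomposes_def
  proof (intro conjI)
    show "\<tau> = A @ q # B @ n # C @ D" by (simp add: 1(1) R C_def D_def)
    show "\<forall>x\<in>set A \<union> set B \<union> set C. q < x" using gt by (auto simp: C_def dest: set_takeWhileD)
    show "\<exists>a\<in>set A. \<exists>c\<in>set C. a < c" using ai cl val(2) by (auto simp: C_def)
    have "q \<notin> set D1" using dist by (simp add: 1(1) R)
    then show "D = [] \<or> hd D < q"
      unfolding D_def by (metis dropWhile_eq_Nil_conv hd_dropWhile hd_in_set linorder_neqE_nat set_dropWhileD)
  qed
  then show ?thesis by blast
qed

lemma decomposes_imp_mesh_contains:
  assumes "\<tau> \<in> permutations_of_set {1..n}" and "decomposes n \<tau> q A B C D"
  shows "mesh_contains \<tau> pattern_2143"
proof -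
  have len: "length \<tau> = n" by (simp add: length_finite_permutations_of_set[OF assms(1)])
  have \<tau>: "\<tau> = A @ q # B @ n # C @ D" and gt: "\<And>x. x \<in> set A \<union> set B \<union> set C \<Longrightarrow> q < x"
    using assms(2) by (auto simp: decomposes_def)
  obtain i r where ir: "i < length A" "r < length C" "A ! i < C ! r"
    using assms(2) by (auto simp: decomposes_def in_set_conv_nth)
  have qn: "q \<le> n" using assms(1) by (auto simp: \<tau> permutations_of_set_def set_eq_iff)
  let ?j = "length A" and ?k = "length A + length B + 1" and ?l = "length A + length B + 2 + r"
  have \<tau>': "\<tau> = (A @ q # B) @ n # C @ D" "\<tau> = (A @ q # B @ [n]) @ C @ D" by (simp_all add: \<tau>)
  have nth: "\<tau> ! i = A ! i" "\<tau> ! ?j = q" "\<tau> ! ?k = n" "\<tau> ! ?l = C ! r"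
  proof -
    show "\<tau> ! i = A ! i" "\<tau> ! ?j = q" using ir by (simp_all add: \<tau> nth_append)
    show "\<tau> ! ?k = n" using nth_append_length[of "A @ q # B" n "C @ D"] unfolding \<tau>'(1) by simp
    have "\<tau> ! (length (A @ q # B @ [n]) + r) = C ! r"
      unfolding \<tau>'(2) nth_append_length_plus using ir by (simp add: nth_append)
    then show "\<tau> ! ?l = C ! r" by simp
  qed
  have "?l < n" using ir(2) arg_cong[OF \<tau>, of length] len by simp
  have "q \<le> \<tau> ! m" if "m < ?l" for m
  proof -
    have "m < length (take ?l \<tau>)" using that \<open>?l < n\<close> len by simp
    then have "\<tau> ! m \<in> set (take ?l \<tau>)" using that by (metis nth_mem nth_take)
    also have "take ?l \<tau> = A @ q # B @ n # take r C" using ir by (simp add: \<tau>)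
    finally show ?thesis using gt[of "\<tau> ! m"] qn by (auto dest: in_set_takeD)
  qed
  moreover note \<open>?l < n\<close>
  moreover have "q < A ! i" using gt ir by simp
  ultimately show ?thesis
    unfolding mesh_contains_2143_iff[OF assms(1)] using ir nth
    by (intro exI[of _ i] exI[of _ ?j] exI[of _ ?k] exI[of _ ?l] conjI) simp_all
qed

lemma append_Cons_eq_iff_notin:
  assumes "x \<notin> set as" "x \<notin> set as'"
  shows "as @ x # bs = as' @ x # bs' \<longleftrightarrow> as = as' \<and> bs = bs'"
  using assms
proof (induction as arbitrary: as')
  case Nil
  then show ?case by (cases as') auto
next
  case (Cons a as)
  then show ?case by (cases as') auto
qed

lemma takeWhile_dropWhile_append:
  assumes "\<forall>x\<in>set C. P x" "D = [] \<or> \<not> P (hd D)"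
  shows "takeWhile P (C @ D) = C" "dropWhile P (C @ D) = D"
  using assms by (cases D; auto simp: takeWhile_append2 dropWhile_append2)+

text \<open>The entries are distinct, so \<open>n\<close> determines the cut between
  \<open>A q B\<close> and \<open>C D\<close>. Then \<open>q\<close> is the minimum of the part
  before \<open>n\<close>, which fixes \<open>A\<close> and \<open>B\<close>, and \<open>C\<close>
  is the longest prefix of the part after \<open>n\<close> with all entries above \<open>q\<close>,
  because \<open>D\<close> is empty or starts below \<open>q\<close>.\<close>

lemma decomposes_unique:
  assumes "distinct \<tau>" "decomposes n \<tau> q A B C D" "decomposes n \<tau> q' A' B' C' D'"
  shows "q = q' \<and> A = A' \<and> B = B' \<and> C = C' \<and> D = D'"
proof -
  have \<tau>: "\<tau> = A @ q # B @ n # C @ D" "\<tau> = A' @ q' # B' @ n # C' @ D'"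
    using assms by (auto simp: decomposes_def)
  have d: "distinct (A @ q # B @ n # C @ D)" "distinct (A' @ q' # B' @ n # C' @ D')"
    using assms(1) \<tau> by metis+
  have "(A @ q # B) @ n # (C @ D) = (A' @ q' # B') @ n # (C' @ D')" using \<tau> by simp
  then have eq: "A @ q # B = A' @ q' # B'" "C @ D = C' @ D'"
    using d by (subst (asm) append_Cons_eq_iff_notin; auto)+
  have "q = Min (set (A @ q # B))" "q' = Min (set (A' @ q' # B'))"
    by (rule Min_eqI[symmetric]; use assms(2,3) in \<open>auto simp: decomposes_def less_imp_le\<close>)+
  then have q: "q = q'" using eq by metis
  have "C = takeWhile ((<) q) (C @ D)" "D = dropWhile ((<) q) (C @ D)"
    "C' = takeWhile ((<) q') (C' @ D')" "D' = dropWhile ((<) q') (C' @ D')"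
    using takeWhile_dropWhile_append[of C "(<) q" D] takeWhile_dropWhile_append[of C' "(<) q'" D']
      assms(2,3) by (auto simp: decomposes_def)
  then have "C = C'" "D = D'" using eq q by metis+
  moreover have "A = A' \<and> B = B'"
    using eq(1) d unfolding q by (subst (asm) append_Cons_eq_iff_notin) auto
  ultimately show ?thesis using q by simp
qed

section \<open>The bijection with triples of words\<close>

definition reduced_triples :: "nat \<Rightarrow> nat \<Rightarrow> nat \<Rightarrow> nat \<Rightarrow> ((nat list \<times> nat list) \<times> nat list) set" where
  "reduced_triples n q k l =
     {((A, C), W). length A = k \<and> length C = l \<and> A @ C @ W \<in> permutations_of_set ({1..n} - {q, n}) \<and>
        set A \<union> set C \<subseteq> {q<..<n} \<and> (\<exists>a\<in>set A. \<exists>c\<in>set C. a < c)}"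

text \<open>Any word \<open>W\<close> avoiding \<open>q\<close> splits in exactly one way into a
  \<open>B\<close> with entries above \<open>q\<close> and a \<open>D\<close> that is empty or
  starts below \<open>q\<close>. Hence \<open>W\<close> carries no order condition of its own, which
  makes the triples easy to count.\<close>

definition assemble :: "nat \<Rightarrow> nat \<times> (nat list \<times> nat list) \<times> nat list \<Rightarrow> nat list" where
  "assemble n = (\<lambda>(q, (A, C), W). A @ q # takeWhile ((<) q) W @ n # C @ dropWhile ((<) q) W)"

lemma decomposes_assemble:
  assumes "((A, C), W) \<in> reduced_triples n q k l"
  shows "decomposes n (assemble n (q, (A, C), W)) q A (takeWhile ((<) q) W) C (dropWhile ((<) q) W)"
proof -
  have "q \<notin> set W" using assms by (auto simp: reduced_triples_def permutations_of_set_def)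
  then have "dropWhile ((<) q) W = [] \<or> hd (dropWhile ((<) q) W) < q"
    by (metis dropWhile_eq_Nil_conv hd_dropWhile hd_in_set linorder_neqE_nat set_dropWhileD)
  then show ?thesis
    using assms by (auto simp: decomposes_def assemble_def reduced_triples_def dest: set_takeWhileD)
qed

lemma assemble_permutation:
  assumes "((A, C), W) \<in> reduced_triples n q k l" "1 \<le> q" "q < n"
  shows "assemble n (q, (A, C), W) \<in> permutations_of_set {1..n}"
proof -
  define B D where "B = takeWhile ((<) q) W" and "D = dropWhile ((<) q) W"
  have W: "W = B @ D" by (simp add: B_def D_def)
  have "set (A @ C @ W) = {1..n} - {q, n}" "distinct (A @ C @ W)"
    using assms by (auto simp: reduced_triples_def permutations_of_set_def)
  moreover have "set (A @ q # B @ n # C @ D) = insert q (insert n (set (A @ C @ W)))"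
    by (auto simp: W)
  moreover have "{1..n} = insert q (insert n ({1..n} - {q, n}))" using assms(2,3) by auto
  moreover have "distinct (A @ q # B @ n # C @ D) \<longleftrightarrow>
      distinct (A @ C @ W) \<and> q \<notin> set (A @ C @ W) \<and> n \<notin> set (A @ C @ W)"
    using assms(3) by (auto simp: W)
  ultimately have "set (A @ q # B @ n # C @ D) = {1..n}" "distinct (A @ q # B @ n # C @ D)"
    by simp_all
  then show ?thesis by (simp add: assemble_def permutations_of_set_def flip: B_def D_def)
qed

text \<open>Injectivity is the uniqueness of the decomposition, surjectivity its existence. The
  ranges of \<open>q\<close>, \<open>k\<close>, \<open>l\<close> express that \<open>A\<close> and
  \<open>C\<close> are nonempty and together fit into the \<open>n - q - 1\<close> values strictly
  between \<open>q\<close> and \<open>n\<close>.\<close>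

lemma bij_betw_assemble:
  "bij_betw (assemble n)
     (SIGMA q:{1..n-3}. \<Union>k\<in>{1..n-q-2}. \<Union>l\<in>{1..n-q-1-k}. reduced_triples n q k l)
     {\<tau> \<in> permutations_of_set {1..n}. mesh_contains \<tau> pattern_2143}"
    (is "bij_betw _ ?S ?T")
proof (rule bij_betw_imageI)
  show "inj_on (assemble n) ?S"
  proof (rule inj_onI)
    fix x y assume xy: "x \<in> ?S" "y \<in> ?S" and eq: "assemble n x = assemble n y"
    obtain q A C W q' A' C' W' where [simp]: "x = (q, (A, C), W)" "y = (q', (A', C'), W')"
      by (metis surj_pair)
    have "distinct (assemble n x)"
      using xy by (auto dest!: assemble_permutation simp: permutations_of_set_def)
    moreover obtain k l k' l' where
      "((A, C), W) \<in> reduced_triples n q k l" "((A', C'), W') \<in> reduced_triples n q' k' l'"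
      using xy by auto
    note this[THEN decomposes_assemble]
    ultimately have *: "q = q' \<and> A = A' \<and> takeWhile ((<) q) W = takeWhile ((<) q') W' \<and>
        C = C' \<and> dropWhile ((<) q) W = dropWhile ((<) q') W'"
      using eq by (intro decomposes_unique[of "assemble n x" n]) simp_all
    then have "W = W'" by (metis takeWhile_dropWhile_id)
    with * show "x = y" by simp
  qed
next
  show "assemble n ` ?S = ?T"
  proof (intro equalityI subsetI)
    fix \<tau> assume "\<tau> \<in> assemble n ` ?S"
    then obtain q A C W k l where \<tau>: "\<tau> = assemble n (q, (A, C), W)" "((A, C), W) \<in> reduced_triples n q k l"
      "1 \<le> q" "q < n" by auto
    then show "\<tau> \<in> ?T"
      using decomposes_imp_mesh_contains[OF assemble_permutation decomposes_assemble] assemble_permutation by blast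
  next
    fix \<tau> assume \<tau>: "\<tau> \<in> ?T"
    then obtain q A B C D where dec: "decomposes n \<tau> q A B C D"
      using mesh_contains_imp_decomposes by blast
    have eq: "\<tau> = A @ q # B @ n # C @ D" and gt: "\<forall>x\<in>set A \<union> set B \<union> set C. q < x"
      and ex: "\<exists>a\<in>set A. \<exists>c\<in>set C. a < c" and D: "D = [] \<or> \<not> q < hd D"
      using dec by (auto simp: decomposes_def)
    have set: "set A \<union> set B \<union> set C \<union> set D \<union> {q, n} = {1..n}" and dist: "distinct (A @ q # B @ n # C @ D)"
      using \<tau> by (auto simp: permutations_of_set_def eq)
    have AC: "set A \<union> set C \<subseteq> {q<..<n}"
    proof
      fix x assume x: "x \<in> set A \<union> set C"
      then have "x \<in> {1..n}" using set by blast
      moreover have "x \<noteq> n" "q < x" using x dist gt by auto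
      ultimately show "x \<in> {q<..<n}" by auto
    qed
    have W: "set (A @ C @ B @ D) = {1..n} - {q, n}" unfolding set[symmetric] using dist by auto
    have "card (set (A @ C)) = length A + length C"
      using dist distinct_card[of "A @ C"] by auto
    then have le: "length A + length C \<le> n - q - 1"
      using AC card_mono[of "{q<..<n}" "set (A @ C)"] by simp
    \<comment> \<open>With \<open>le\<close> this gives \<open>2 <= n - q - 1\<close>, which is the
      bound \<open>q <= n - 3\<close>.\<close>
    have pos: "length A \<ge> 1" "length C \<ge> 1" using ex by (auto simp: Suc_le_eq)
    have "q \<in> {1..n}" using set by blast
    have "((A, C), B @ D) \<in> reduced_triples n q (length A) (length C)"
      using W AC ex dist by (auto simp: reduced_triples_def permutations_of_set_def)
    moreover have "q \<in> {1..n-3}" "length A \<in> {1..n-q-2}" "length C \<in> {1..n-q-1-length A}"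
      using le pos \<open>q \<in> {1..n}\<close> by auto
    ultimately have "(q, (A, C), B @ D) \<in> ?S" by blast
    moreover have "\<tau> = assemble n (q, (A, C), B @ D)"
      using takeWhile_dropWhile_append[of B "(<) q" D] gt D by (simp add: eq assemble_def)
    ultimately show "\<tau> \<in> assemble n ` ?S" by blast
  qed
qed

subsection \<open>Counting\<close>

lemma card_append_permutations_of_set:
  assumes "finite X" "k \<le> card X"
  shows "card {(A, C). length A = k \<and> A @ C \<in> permutations_of_set X} = fact (card X)"
proof -
  have "bij_betw (\<lambda>(A, C). A @ C) {(A, C). length A = k \<and> A @ C \<in> permutations_of_set X}
          (permutations_of_set X)"
    by (rule bij_betw_byWitness[where f' = "\<lambda>xs. (take k xs, drop k xs)"])
      (use assms in \<open>auto simp: length_finite_permutations_of_set\<close>)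
  then show ?thesis using assms by (simp add: bij_betw_same_card)
qed

lemma finite_append_permutations_of_set:
  "finite {(A, C). length A = k \<and> A @ C \<in> permutations_of_set X}"
  by (rule finite_subset[of _ "(\<lambda>xs. (take k xs, drop k xs)) ` permutations_of_set X"]) force+

lemma ex_upper_subset:
  fixes X :: "'a::linorder set"
  assumes "finite X" "card X = k + l"
  obtains U where "U \<subseteq> X" "card U = k" "\<And>u v. u \<in> U \<Longrightarrow> v \<in> X - U \<Longrightarrow> v < u"
proof
  define xs where "xs = sorted_list_of_set X"
  have xs: "set xs = X" "distinct xs" "length xs = k + l" "sorted xs"
    using assms by (auto simp: xs_def)
  have sep: "\<forall>v\<in>set (take l xs). \<forall>u\<in>set (drop l xs). v \<le> u"
    using xs(4) by (metis append_take_drop_id sorted_append)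
  have split: "X = set (take l xs) \<union> set (drop l xs)"
    using xs(1) by (metis append_take_drop_id set_append)
  show "set (drop l xs) \<subseteq> X" using split by blast
  show "card (set (drop l xs)) = k" using xs by (simp add: distinct_card)
  show "v < u" if "u \<in> set (drop l xs)" "v \<in> X - set (drop l xs)" for u v
    using that sep split by (metis DiffE UnE order_le_less)
qed

text \<open>Two upper subsets are comparable under inclusion: elements \<open>u\<close> of
  \<open>U - Y\<close> and \<open>y\<close> of \<open>Y - U\<close> would satisfy both
  \<open>y < u\<close> and \<open>u < y\<close>. Equal cardinality then forces equality.\<close>

lemma upper_subset_unique:
  fixes X :: "'a::linorder set"
  assumes "finite X" "U \<subseteq> X" "Y \<subseteq> X" "card U = card Y"
    and "\<And>u v. u \<in> U \<Longrightarrow> v \<in> X - U \<Longrightarrow> v < u" "\<And>u v. u \<in> Y \<Longrightarrow> v \<in> X - Y \<Longrightarrow> v < u"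
  shows "U = Y"
proof -
  have fin: "finite U" "finite Y" using assms finite_subset by auto
  have "U \<subseteq> Y \<or> Y \<subseteq> U"
  proof (rule ccontr)
    assume "\<not> ?thesis"
    then obtain u y where "u \<in> U" "u \<notin> Y" "y \<in> Y" "y \<notin> U" by blast
    then have "y < u" "u < y" using assms by blast+
    then show False by simp
  qed
  then show ?thesis
    using card_subset_eq[OF fin(1), of Y] card_subset_eq[OF fin(2), of U] assms(4) by auto
qed

text \<open>The content of \<open>A\<close> can only be the set of the \<open>k\<close> largest
  elements of \<open>X\<close>, so the pairs form a product of two sets of arrangements.\<close>

lemma card_separated_permutations:
  fixes X :: "'a::linorder set"
  assumes "finite X" "card X = k + l"
  shows "card {(A, C). length A = k \<and> A @ C \<in> permutations_of_set X \<and>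
           (\<forall>a\<in>set A. \<forall>c\<in>set C. c < a)} = fact k * fact l" (is "card ?S = _")
proof -
  obtain U where U: "U \<subseteq> X" "card U = k" "\<And>u v. u \<in> U \<Longrightarrow> v \<in> X - U \<Longrightarrow> v < u"
    using ex_upper_subset[OF assms] by blast
  have fin: "finite U" using U assms finite_subset by auto
  have "?S = permutations_of_set U \<times> permutations_of_set (X - U)" (is "_ = ?T")
  proof (intro equalityI subsetI)
    fix z assume "z \<in> ?S"
    then obtain A C where z: "z = (A, C)" "length A = k" "set A \<union> set C = X" "distinct (A @ C)"
      "\<forall>a\<in>set A. \<forall>c\<in>set C. c < a" by (auto simp: permutations_of_set_def)
    then have "U = set A"
      using assms U by (intro upper_subset_unique[of X]) (auto simp: distinct_card)
    then show "z \<in> ?T" using z by (auto simp: permutations_of_set_def)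
  next
    fix z assume "z \<in> ?T"
    then show "z \<in> ?S" using U fin
      by (auto simp: permutations_of_set_def distinct_card)
  qed
  then show ?thesis
    using assms U fin by (simp add: card_cartesian_product card_Diff_subset)
qed

text \<open>A complement count: the entries of \<open>A @ C\<close> are distinct, so failing to have
  some \<open>a < c\<close> means that every \<open>c\<close> lies below every
  \<open>a\<close>.\<close>

lemma card_not_separated_permutations:
  fixes X :: "'a::linorder set"
  assumes "finite X" "card X = k + l"
  shows "card {(A, C). length A = k \<and> A @ C \<in> permutations_of_set X \<and>
           (\<exists>a\<in>set A. \<exists>c\<in>set C. a < c)} = fact (k + l) - fact k * fact l" (is "card ?S = _")
proof -
  let ?All = "{(A, C). length A = k \<and> A @ C \<in> permutations_of_set X}"
  let ?Sep = "{(A, C). length A = k \<and> A @ C \<in> permutations_of_set X \<and>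
           (\<forall>a\<in>set A. \<forall>c\<in>set C. c < a)}"
  have iff: "(\<exists>a\<in>set A. \<exists>c\<in>set C. a < c) \<longleftrightarrow> \<not> (\<forall>a\<in>set A. \<forall>c\<in>set C. c < a)"
    if "A @ C \<in> permutations_of_set X" for A C
  proof -
    have "c < a \<longleftrightarrow> \<not> a < c" if "a \<in> set A" "c \<in> set C" for a c
      using that \<open>A @ C \<in> _\<close> by (auto simp: permutations_of_set_def not_less order_le_less)
    then show ?thesis by blast
  qed
  have "?S = ?All - ?Sep"
  proof (rule set_eqI)
    fix z show "z \<in> ?S \<longleftrightarrow> z \<in> ?All - ?Sep"
      by (cases z) (use iff in \<open>simp only: mem_Collect_eq case_prod_conv Diff_iff, blast\<close>)
  qed
  moreover have "?Sep \<subseteq> ?All" by auto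
  moreover have "card ?All = fact (k + l)"
    using card_append_permutations_of_set[of X k] assms by simp
  moreover note finite_append_permutations_of_set[of k X]
  ultimately show ?thesis
    using card_separated_permutations[OF assms] by (simp add: card_Diff_subset finite_subset)
qed

text \<open>The pairing \<open>((A, C), W)\<close> makes the set a disjoint union of products over the common
  content \<open>X\<close> of \<open>A\<close> and \<open>C\<close>.\<close>

lemma card_prefix_not_separated:
  fixes E L :: "'a::linorder set"
  assumes "finite E" "L \<subseteq> E"
  shows "card {((A, C), W). length A = k \<and> length C = l \<and> A @ C @ W \<in> permutations_of_set E \<and>
           set A \<union> set C \<subseteq> L \<and> (\<exists>a\<in>set A. \<exists>c\<in>set C. a < c)} =
         (card L choose (k + l)) * ((fact (k + l) - fact k * fact l) * fact (card E - (k + l)))"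
    (is "card ?S = _")
proof -
  have finL: "finite L" using assms finite_subset by auto
  define G where "G = (\<lambda>X. {(A, C). length A = k \<and> A @ C \<in> permutations_of_set X \<and>
           (\<exists>a\<in>set A. \<exists>c\<in>set C. a < c)} \<times> permutations_of_set (E - X))"
  define I where "I = {X. X \<subseteq> L \<and> card X = k + l}"
  have finI: "finite I" using finL by (simp add: I_def)
  have finX: "finite X" "X \<subseteq> E" if "X \<in> I" for X
    using that assms finL by (auto simp: I_def intro: finite_subset)
  have cardG: "card (G X) = (fact (k + l) - fact k * fact l) * fact (card E - (k + l))"
    if "X \<in> I" for X
    using that finX[OF that] card_not_separated_permutations[of X k l] assms
    by (simp add: G_def I_def card_cartesian_product card_Diff_subset)
  have "?S = (\<Union>X\<in>I. G X)"
  proof (intro equalityI subsetI)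
    fix z assume "z \<in> ?S"
    then obtain A C W where z: "z = ((A, C), W)" "length A = k" "length C = l"
        "A @ C @ W \<in> permutations_of_set E" "set A \<union> set C \<subseteq> L" "\<exists>a\<in>set A. \<exists>c\<in>set C. a < c"
      by blast
    then have "set A \<union> set C \<in> I"
      using distinct_card[of "A @ C"] by (auto simp: I_def permutations_of_set_def)
    moreover have "z \<in> G (set A \<union> set C)"
      using z by (auto simp: G_def permutations_of_set_def)
    ultimately show "z \<in> (\<Union>X\<in>I. G X)" by blast
  next
    fix z assume "z \<in> (\<Union>X\<in>I. G X)"
    then obtain X where X: "X \<in> I" "z \<in> G X" by blast
    obtain A C W where "z = ((A, C), W)" by (metis surj_pair)
    with X have z: "X \<in> I" "z = ((A, C), W)" "length A = k"
      "set A \<union> set C = X" "distinct (A @ C)" "\<exists>a\<in>set A. \<exists>c\<in>set C. a < c"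
      "set W = E - X" "distinct W"
      by (auto simp: G_def permutations_of_set_def)
    \<comment> \<open>\<open>G X\<close> prescribes only the length of \<open>A\<close>; that of
      \<open>C\<close> comes from the cardinality of \<open>X\<close>.\<close>
    moreover have "length (A @ C) = k + l"
      using z by (metis (mono_tags, lifting) I_def distinct_card mem_Collect_eq set_append)
    ultimately show "z \<in> ?S"
      using finX[OF z(1)] by (auto simp: I_def permutations_of_set_def)
  qed
  moreover have "card (\<Union>X\<in>I. G X) = (\<Sum>X\<in>I. card (G X))"
  proof (rule card_UN_disjoint)
    show "\<forall>X\<in>I. finite (G X)"
      unfolding G_def
      by (auto intro!: finite_cartesian_product
          finite_subset[OF _ finite_append_permutations_of_set[of k]])
    show "\<forall>X\<in>I. \<forall>Y\<in>I. X \<noteq> Y \<longrightarrow> G X \<inter> G Y = {}"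
      by (auto simp: G_def permutations_of_set_def)
  qed (fact finI)
  ultimately show ?thesis
    using cardG by (simp add: I_def n_subsets[OF finL])
qed

section \<open>Evaluating the count of triples and summing it\<close>

lemma finite_reduced_triples: "finite (reduced_triples n q k l)"
proof (rule finite_subset)
  let ?E = "{xs. set xs \<subseteq> {1..n} \<and> length xs \<le> n}"
  show "reduced_triples n q k l \<subseteq> (?E \<times> ?E) \<times> ?E"
  proof clarsimp
    fix A C W assume "((A, C), W) \<in> reduced_triples n q k l"
    then have *: "A @ C @ W \<in> permutations_of_set ({1..n} - {q, n})"
      by (simp add: reduced_triples_def)
    have "card ({1..n} - {q, n}) \<le> n" using card_mono[of "{1..n}" "{1..n} - {q, n}"] by auto
    then have "length (A @ C @ W) \<le> n" using length_finite_permutations_of_set[OF *] by simp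
    moreover have "set (A @ C @ W) \<subseteq> {1..n}" using * by (auto simp del: set_append dest!: permutations_of_setD(1))
    ultimately show "set A \<subseteq> {Suc 0..n} \<and> length A \<le> n \<and> set C \<subseteq> {Suc 0..n} \<and> length C \<le> n \<and>
       set W \<subseteq> {Suc 0..n} \<and> length W \<le> n"
      by auto
  qed
  show "finite ((?E \<times> ?E) \<times> ?E)"
    by (intro finite_cartesian_product finite_lists_length_le) auto
qed

text \<open>Links the summand of the formula to the shape produced by counting, where
  \<open>q\<close> enters only through one binomial coefficient. With \<open>s = k + l\<close>, both
  sides equal \<open>(n-q-1)! (n-2-s)! / (n-q-1-s)!\<close> times the last factor. This serves the
  exact count and later the summation over \<open>q\<close>.\<close>

lemma summand_eq:
  assumes "1 \<le> q" "k + l + q < n"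
  shows "fact (n - 2) / real ((n - 2) choose (q - 1)) * real ((n - k - l - 2) choose (q - 1))
      * (1 - 1 / real ((k + l) choose k)) =
    real ((n - q - 1) choose (k + l)) *
      (fact (k + l) * fact (n - 2 - (k + l)) * (1 - 1 / real ((k + l) choose k)))"
proof -
  let ?s = "k + l"
  have "real ((n - q - 1) choose ?s) = fact (n - q - 1) / (fact ?s * fact (n - q - 1 - ?s))"
    using assms by (intro binomial_fact) auto
  also have "fact (n - q - 1) / (fact ?s * fact (n - q - 1 - ?s)) *
      (fact ?s * fact (n - 2 - ?s) * (1 - 1 / real (?s choose k))) =
      fact (n - q - 1) * fact (n - 2 - ?s) / fact (n - q - 1 - ?s) * (1 - 1 / real (?s choose k))"
    by (simp add: field_simps)
  also have "fact (n - q - 1) * fact (n - 2 - ?s) / fact (n - q - 1 - ?s) =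
      fact (n - 2) / real ((n - 2) choose (q - 1)) * real ((n - k - l - 2) choose (q - 1))"
  proof -
    have "n - 2 - (q - 1) = n - q - 1" "n - k - l - 2 - (q - 1) = n - q - 1 - ?s"
      using assms by auto
    then have bin: "real ((n - 2) choose (q - 1)) = fact (n - 2) / (fact (q - 1) * fact (n - q - 1))"
      "real ((n - k - l - 2) choose (q - 1)) =
        fact (n - k - l - 2) / (fact (q - 1) * fact (n - q - 1 - ?s))"
      using assms binomial_fact[of "q - 1" "n - 2", where 'a = real] binomial_fact[of "q - 1" "n - k - l - 2", where 'a = real]
      by (simp_all del: fact_binomial)
    have "n - k - l - 2 = n - 2 - ?s" by simp
    \<comment> \<open>Both \<open>(q-1)!\<close> and \<open>(n-2)!\<close> cancel.\<close>
    then show ?thesis unfolding bin by (simp del: fact_binomial)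
  qed
  finally show ?thesis by (rule sym)
qed

lemma card_reduced_triples:
  assumes "1 \<le> q" "k + l + q < n"
  shows "real (card (reduced_triples n q k l)) =
    fact (n - 2) / real ((n - 2) choose (q - 1)) * real ((n - k - l - 2) choose (q - 1))
      * (1 - 1 / real ((k + l) choose k))"
proof -
  let ?s = "k + l"
  have "card (reduced_triples n q k l) = (card {q<..<n} choose ?s) *
      ((fact ?s - fact k * fact l) * fact (card ({1..n} - {q, n}) - ?s))"
    unfolding reduced_triples_def using assms by (intro card_prefix_not_separated) auto
  also have "card {q<..<n} = n - q - 1" by simp
  also have "card ({1..n} - {q, n}) = n - 2"
    using assms by (subst card_Diff_subset) auto
  \<comment> \<open>The subtraction on naturals is not truncated, because \<open>k! l!\<close>
    divides \<open>(k+l)!\<close> and so does not exceed it.\<close>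
  finally have "real (card (reduced_triples n q k l)) = real ((n - q - 1) choose ?s) *
      ((fact ?s - fact k * fact l) * fact (n - 2 - ?s))"
    by (simp add: of_nat_diff fact_fact_dvd_fact dvd_imp_le)
  also have "\<dots> = real ((n - q - 1) choose ?s) *
      (fact ?s * fact (n - 2 - ?s) * (1 - 1 / real (?s choose k)))"
    by (simp add: binomial_fact field_simps)
  finally show ?thesis using summand_eq[OF assms] by simp
qed

lemma s_plus_2143:
  "real (s_plus n pattern_2143) =
     (\<Sum>q=1..n-3. \<Sum>k=1..n-q-2. \<Sum>l=1..n-q-1-k.
        fact (n-2) / real ((n-2) choose (q-1)) * real ((n-k-l-2) choose (q-1))
          * (1 - 1 / real ((k+l) choose k)))"
proof -
  let ?T = "\<lambda>q k. \<Union>l\<in>{1..n-q-1-k}. reduced_triples n q k l"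
  let ?U = "\<lambda>q. \<Union>k\<in>{1..n-q-2}. ?T q k"
  \<comment> \<open>The lengths of \<open>A\<close> and \<open>C\<close> can be read off a triple,
    so the unions become sums of cardinalities.\<close>
  have disjl: "reduced_triples n q k l \<inter> reduced_triples n q k' l' = {}" if "(k, l) \<noteq> (k', l')" for q k l k' l'
    using that by (auto simp: reduced_triples_def)
  have finT: "finite (?T q k)" for q k using finite_reduced_triples by auto
  have T: "card (?T q k) = (\<Sum>l=1..n-q-1-k. card (reduced_triples n q k l))" for q k
    using disjl by (intro card_UN_disjoint) (auto simp: finite_reduced_triples)
  have U: "card (?U q) = (\<Sum>k=1..n-q-2. card (?T q k))" for q
    using disjl finT by (intro card_UN_disjoint) (auto, blast)
  have "s_plus n pattern_2143 = card (SIGMA q:{1..n-3}. ?U q)"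
    unfolding s_plus_def using bij_betw_same_card[OF bij_betw_assemble] by simp
  also have "\<dots> = (\<Sum>q=1..n-3. card (?U q))"
    using finT by (subst card_SigmaI) auto
  also have "\<dots> = (\<Sum>q=1..n-3. \<Sum>k=1..n-q-2. \<Sum>l=1..n-q-1-k. card (reduced_triples n q k l))"
    by (simp only: T U)
  finally have "real (s_plus n pattern_2143) =
      (\<Sum>q=1..n-3. \<Sum>k=1..n-q-2. \<Sum>l=1..n-q-1-k. real (card (reduced_triples n q k l)))"
    by simp
  also have "\<dots> = (\<Sum>q=1..n-3. \<Sum>k=1..n-q-2. \<Sum>l=1..n-q-1-k.
        fact (n-2) / real ((n-2) choose (q-1)) * real ((n-k-l-2) choose (q-1))
          * (1 - 1 / real ((k+l) choose k)))"
    by (intro sum.cong refl card_reduced_triples) auto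
  finally show ?thesis .
qed

subsection \<open>Asymptotics\<close>

lemma sum_binomial_diff:
  assumes "s + 1 \<le> m"
  shows "(\<Sum>q=1..m - s. (m - q) choose s) = m choose (s + 1)"
proof -
  have "(\<Sum>q=1..m - s. (m - q) choose s) = (\<Sum>j=s..m - 1. j choose s)"
    by (rule sum.reindex_bij_witness[of _ "\<lambda>j. m - j" "\<lambda>q. m - q"]) (use assms in auto)
  \<comment> \<open>The added terms with \<open>j < s\<close> vanish, which brings the sum into
    hockey-stick form.\<close>
  also have "\<dots> = (\<Sum>j\<le>m - 1. j choose s)"
    by (rule sum.mono_neutral_left) auto
  also have "\<dots> = m choose (s + 1)"
    using sum_choose_upper[of s "m - 1"] assms by (simp add: Suc_diff_Suc)
  finally show ?thesis .
qed

text \<open>By Pascal's rule: one summand is at least 1 and the other is at least \<open>n\<close>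
  by induction. The border case \<open>k = n\<close> in row \<open>Suc n\<close> is computed
  directly.\<close>

lemma le_binomial: "0 < k \<Longrightarrow> k < n \<Longrightarrow> n \<le> n choose k"
proof (induction n arbitrary: k)
  case (Suc n)
  then obtain j where k: "k = Suc j" by (cases k) auto
  have "1 \<le> n choose j" using Suc k by (simp add: Suc_le_eq)
  moreover have "n \<le> n choose Suc j" if "Suc j < n" using Suc k that by simp
  ultimately show ?case
    using Suc.prems k by (cases "Suc j < n") (auto simp: less_Suc_eq binomial_Suc_n)
qed simp

lemma triple_sum_eq:
  "(\<Sum>q=1..n-3. \<Sum>k=1..n-q-2. \<Sum>l=1..n-q-1-k.
     fact (n-2) / real ((n-2) choose (q-1)) * real ((n-k-l-2) choose (q-1))
       * (1 - 1 / real ((k+l) choose k))) =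
    (\<Sum>s=2..n-2. \<Sum>k=1..s-1. fact (n - 1) / real (s + 1) * (1 - 1 / real (s choose k)))"
proof -
  \<comment> \<open>The part of the summand that does not depend on \<open>q\<close>.\<close>
  define w :: "nat \<Rightarrow> nat \<Rightarrow> real" where
    "w = (\<lambda>s k. fact s * fact (n - 2 - s) * (1 - 1 / real (s choose k)))"
  have "(\<Sum>q=1..n-3. \<Sum>k=1..n-q-2. \<Sum>l=1..n-q-1-k.
     fact (n-2) / real ((n-2) choose (q-1)) * real ((n-k-l-2) choose (q-1))
       * (1 - 1 / real ((k+l) choose k))) =
    (\<Sum>q=1..n-3. \<Sum>k=1..n-q-2. \<Sum>l=1..n-q-1-k. real ((n - q - 1) choose (k + l)) * w (k + l) k)"
    unfolding w_def by (intro sum.cong refl summand_eq) auto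
  also have "\<dots> = (\<Sum>(q, k, l)\<in>(SIGMA q:{1..n-3}. SIGMA k:{1..n-q-2}. {1..n-q-1-k}).
      real ((n - q - 1) choose (k + l)) * w (k + l) k)"
    by (simp add: sum.Sigma)
  \<comment> \<open>For fixed \<open>s = k + l\<close> the condition
    \<open>l <= n - q - 1 - k\<close> reads \<open>q <= n - 1 - s\<close>, independently of
    \<open>k\<close>.\<close>
  also have "\<dots> = (\<Sum>(s, k, q)\<in>(SIGMA s:{2..n-2}. {1..s-1} \<times> {1..n-1-s}).
      real ((n - 1 - q) choose s) * w s k)"
    by (rule sum.reindex_bij_witness[of _ "\<lambda>(s, k, q). (q, k, s - k)" "\<lambda>(q, k, l). (k + l, k, q)"])
      auto
  also have "\<dots> = (\<Sum>s=2..n-2. \<Sum>k=1..s-1. \<Sum>q=1..n-1-s. real ((n - 1 - q) choose s) * w s k)"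
    by (simp add: sum.Sigma sum.cartesian_product)
  also have "\<dots> = (\<Sum>s=2..n-2. \<Sum>k=1..s-1. fact (n - 1) / real (s + 1) * (1 - 1 / real (s choose k)))"
  proof (intro sum.cong refl)
    fix s k assume s: "s \<in> {2..n-2}"
    have "(\<Sum>q=1..n-1-s. real ((n - 1 - q) choose s) * w s k) = real ((n - 1) choose (s + 1)) * w s k"
    proof -
      have "s + 1 \<le> n - 1" using s by auto
      then show ?thesis
        by (simp only: sum_binomial_diff flip: sum_distrib_right of_nat_sum)
    qed
    also have "real ((n - 1) choose (s + 1)) = fact (n - 1) / (fact (s + 1) * fact (n - 2 - s))"
    proof -
      have "s + 1 \<le> n - 1" using s by auto
      then show ?thesis using binomial_fact[of "s + 1" "n - 1", where 'a = real] by simp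
    qed
    \<comment> \<open>The factors \<open>s! (n-2-s)!\<close> of \<open>w\<close> cancel all of the
      denominator except \<open>s + 1\<close>.\<close>
    also have "\<dots> * w s k = fact (n - 1) / real (s + 1) * (1 - 1 / real (s choose k))"
      by (simp add: w_def)
    finally show "(\<Sum>q=1..n-1-s. real ((n - 1 - q) choose s) * w s k) =
      fact (n - 1) / real (s + 1) * (1 - 1 / real (s choose k))" .
  qed
  finally show ?thesis .
qed

text \<open>Each new term \<open>1/(m+2)\<close> is at most the increment of the logarithm, by
  \<open>ln x <= x - 1\<close> at \<open>x = (m+1)/(m+2)\<close>.\<close>

lemma sum_inverse_le_ln: "(\<Sum>s=2..m. 1 / real (s + 1)) \<le> ln (real m + 1)"
proof (induction m)
  case (Suc m)
  have "ln ((real m + 1) / (real m + 2)) \<le> (real m + 1) / (real m + 2) - 1"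
    by (intro ln_le_minus_one) auto
  also have "\<dots> = - (1 / (real m + 2))" by (simp add: field_simps)
  finally have "1 / (real m + 2) \<le> ln (real m + 2) - ln (real m + 1)"
    by (simp add: ln_div)
  \<comment> \<open>For \<open>m = 0\<close> the sum is still empty and gains no term.\<close>
  with Suc show ?case by (cases "m = 0") (auto simp: add_ac)
qed simp

lemma triple_sum_lower:
  assumes "4 \<le> n"
  shows "(real n - 3) / real n - 3 * (ln (real n) / real n) \<le>
    (\<Sum>s=2..n-2. \<Sum>k=1..s-1. fact (n - 1) / real (s + 1) * (1 - 1 / real (s choose k))) / fact n"
proof -
  have "real n - 3 - 3 * ln (real n) \<le> real n - 3 - 3 * (\<Sum>s=2..n-2. 1 / real (s + 1))"
  proof -
    have "(\<Sum>s=2..n-2. 1 / real (s + 1)) \<le> ln (real (n - 2) + 1)" by (rule sum_inverse_le_ln)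
    also have "\<dots> \<le> ln (real n)" using assms by (simp add: of_nat_diff)
    finally show ?thesis by simp
  qed
  \<comment> \<open>The range of \<open>s\<close> has \<open>n - 3\<close> elements.\<close>
  also have "\<dots> = (\<Sum>s=2..n-2. 1 - 3 / real (s + 1))"
    using assms by (simp add: sum_subtractf sum_distrib_left of_nat_diff)
  also have "\<dots> \<le> (\<Sum>s=2..n-2. \<Sum>k=1..s-1. 1 / real (s + 1) * (1 - 1 / real (s choose k)))"
  proof (rule sum_mono)
    fix s assume s: "s \<in> {2..n-2}"
    have "(s + 1) * (1 - 3 / real (s + 1)) = real s - 2" by (simp add: field_simps)
    \<comment> \<open>The right side is \<open>s - 2 + 1/s\<close>; its factor \<open>s - 1\<close>
      is the number of values of \<open>k\<close>.\<close>
    also have "real s - 2 \<le> real (s - 1) * (1 - 1 / real s)"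
      using s by (simp add: field_simps of_nat_diff)
    finally have "1 - 3 / real (s + 1) \<le> (\<Sum>k=1..s-1. 1 / real (s + 1) * (1 - 1 / real s))"
      by (simp add: field_simps)
    also have "\<dots> \<le> (\<Sum>k=1..s-1. 1 / real (s + 1) * (1 - 1 / real (s choose k)))"
    proof (intro sum_mono mult_left_mono diff_mono order.refl divide_left_mono)
      fix k assume k: "k \<in> {1..s-1}"
      show "real s \<le> real (s choose k)" using le_binomial[of k s] k by force
      have "0 < s choose k" using k by (intro zero_less_binomial) auto
      then show "0 < real (s choose k) * real s" using k by auto
    qed auto
    finally show "1 - 3 / real (s + 1) \<le> (\<Sum>k=1..s-1. 1 / real (s + 1) * (1 - 1 / real (s choose k)))" .
  qed
  finally have "(real n - 3 - 3 * ln (real n)) / real n \<le>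
     (\<Sum>s=2..n-2. \<Sum>k=1..s-1. 1 / real (s + 1) * (1 - 1 / real (s choose k))) / real n"
    by (rule divide_right_mono) simp
  also have "\<dots> = (\<Sum>s=2..n-2. \<Sum>k=1..s-1. fact (n - 1) / real (s + 1) * (1 - 1 / real (s choose k))) / fact n"
  proof -
    have "fact n = real n * fact (n - 1)" using assms by (simp add: fact_reduce)
    moreover have "(\<Sum>s=2..n-2. \<Sum>k=1..s-1. fact (n - 1) / real (s + 1) * (1 - 1 / real (s choose k))) =
      fact (n - 1) * (\<Sum>s=2..n-2. \<Sum>k=1..s-1. 1 / real (s + 1) * (1 - 1 / real (s choose k)))"
      by (simp add: sum_distrib_left)
    ultimately show ?thesis by simp
  qed
  finally show ?thesis by (simp add: diff_divide_distrib)
qed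

lemma s_plus_le_fact: "s_plus n p \<le> fact n"
proof -
  have "s_plus n p \<le> card (permutations_of_set {1..n})"
    unfolding s_plus_def by (intro card_mono) auto
  then show ?thesis by simp
qed

theorem theorem4p9:
  shows "(\<forall>n\<ge>4. real (s_plus n pattern_2143) =
            (\<Sum>q=1..n-3. \<Sum>k=1..n-q-2. \<Sum>l=1..n-q-1-k.
               fact (n-2) / real ((n-2) choose (q-1)) * real ((n-k-l-2) choose (q-1))
                 * (1 - 1 / real ((k+l) choose k))))
         \<and> (\<lambda>n. real (s_plus n pattern_2143) / fact n) \<longlonglongrightarrow> 1"
proof (intro conjI allI impI s_plus_2143)
  show "(\<lambda>n. real (s_plus n pattern_2143) / fact n) \<longlonglongrightarrow> 1"
  \<comment> \<open>The upper bound is the constant 1, since the quotient is a proportion of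
    \<open>S_n\<close>.\<close>
  proof (rule tendsto_sandwich)
    have "(\<lambda>n. ln (real n) / real n) \<longlonglongrightarrow> 0"
      using filterlim_compose[OF ln_x_over_x_tendsto_0 filterlim_real_sequentially] .
    moreover have "(\<lambda>n. 3 / real n) \<longlonglongrightarrow> 0"
      by (rule lim_const_over_n)
    ultimately have "(\<lambda>n. 1 - 3 / real n - 3 * (ln (real n) / real n)) \<longlonglongrightarrow> 1 - 0 - 3 * 0"
      by (intro tendsto_intros)
    then show "(\<lambda>n. 1 - 3 / real n - 3 * (ln (real n) / real n)) \<longlonglongrightarrow> 1" by simp
    show "\<forall>\<^sub>F n in sequentially. 1 - 3 / real n - 3 * (ln (real n) / real n)
            \<le> real (s_plus n pattern_2143) / fact n"
      using eventually_ge_at_top[of 4]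
    proof eventually_elim
      case (elim n)
      then show ?case
        using triple_sum_lower[of n] unfolding s_plus_2143 triple_sum_eq by (simp add: diff_divide_distrib)
    qed
    show "\<forall>\<^sub>F n in sequentially. real (s_plus n pattern_2143) / fact n \<le> 1"
      using s_plus_le_fact[of _ pattern_2143]
      by (intro always_eventually allI) (metis divide_le_eq_1 fact_gt_zero of_nat_fact of_nat_le_iff)
  qed simp
qed

end
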